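(* There are TRSs that are polynomially terminating over $\mathbb{N}$ but are not polynomially terminating over $\mathbb{R}$ and not polynomially terminating over $\mathbb{Q}$.
   Context: A polynomial interpretation over $\mathbb{N}$ for a signature $\mathcal{F}$ assigns to each $n$-ary $f$ a polynomial $f_\mathbb{N} \in \mathbb{Z}[x_1,\dots,x_n]$ such that $f_\mathbb{N}(\mathbb{N}^n) \subseteq \mathbb{N}$ and $f_\mathbb{N}$ is strictly monotone in every argument with respect to the standard order $>$ on $\mathbb{N}$; it is compatible with a TRS $\mathcal{R}$ if $[\alpha](\ell) > [\alpha](r)$ for every rule $\ell \to r$ and every assignment $\alpha$ of variables into $\mathbb{N}$; $\mathcal{R}$ is polynomially terminating over $\mathbb{N}$ if such a compatible interpretation exists. For $D \in \{\mathbb{Q},\mathbb{R}\}$, with $D_0 = \{x\in D : x\ge 0\}$: a polynomial interpretation over $D$ consists of $\delta \in D$, $\delta>0$, and polynomials $f_D \in D[x_1,\dots,x_n]$ with $f_D(D_0^n) \subseteq D_0$; define $x >_{D_0,\delta} y$ iff $x - y \ge \delta$; it is strictly monotone if every $f_D$ is monotone in each argument w.r.t. $>_{D_0,\delta}$ on $D_0$, and compatible with $\mathcal{R}$ if $[\alpha](\ell) >_{D_0,\delta} [\alpha](r)$ for all rules and all assignments into $D_0$; $\mathcal{R}$ is polynomially terminating over $D$ if there is a strictly monotone compatible polynomial interpretation over $D$. *)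

theory Defs
  imports Complex_Main "HOL-Library.Poly_Mapping"
begin

datatype ('f, 'v) trm = Var 'v | Fun 'f "('f, 'v) trm list"

fun vars_trm :: "('f, 'v) trm \<Rightarrow> 'v set" where
  "vars_trm (Var x) = {x}"
| "vars_trm (Fun f ts) = (\<Union>t \<in> set ts. vars_trm t)"

text \<open>A signature is a set \<open>F\<close> of function symbols together with an arity function \<open>ar\<close>.\<close>

fun wf_trm :: "'f set \<Rightarrow> ('f \<Rightarrow> nat) \<Rightarrow> ('f, 'v) trm \<Rightarrow> bool" where
  "wf_trm F ar (Var x) \<longleftrightarrow> True"
| "wf_trm F ar (Fun f ts) \<longleftrightarrow> f \<in> F \<and> length ts = ar f \<and> (\<forall>t \<in> set ts. wf_trm F ar t)"

type_synonym ('f, 'v) rule = "('f, 'v) trm \<times> ('f, 'v) trm"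

definition trs :: "'f set \<Rightarrow> ('f \<Rightarrow> nat) \<Rightarrow> ('f, 'v) rule set \<Rightarrow> bool" where
  "trs F ar R \<longleftrightarrow> finite F \<and> finite R \<and>
     (\<forall>(l, r) \<in> R. wf_trm F ar l \<and> wf_trm F ar r \<and>
        (\<nexists>x. l = Var x) \<and> vars_trm r \<subseteq> vars_trm l)"

text \<open>Multivariate polynomials as finitely supported maps from monomials (finitely supported
  exponent vectors) to coefficients; the indeterminates of an \<open>n\<close>-variate polynomial are
  numbered \<open>0, \<dots>, n - 1\<close>.\<close>

type_synonym 'a mpoly = "(nat \<Rightarrow>\<^sub>0 nat) \<Rightarrow>\<^sub>0 'a"

definition eval_mpoly :: "'a::comm_ring_1 mpoly \<Rightarrow> (nat \<Rightarrow> 'a) \<Rightarrow> 'a" where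
  "eval_mpoly p x =
     (\<Sum>m \<in> Poly_Mapping.keys p. Poly_Mapping.lookup p m *
        (\<Prod>i \<in> Poly_Mapping.keys m. x i ^ Poly_Mapping.lookup m i))"

definition in_vars :: "nat \<Rightarrow> 'a::comm_ring_1 mpoly \<Rightarrow> bool" where
  "in_vars n p \<longleftrightarrow> (\<forall>m \<in> Poly_Mapping.keys p. Poly_Mapping.keys m \<subseteq> {..<n})"

definition maps_into :: "'a::comm_ring_1 set \<Rightarrow> nat \<Rightarrow> 'a mpoly \<Rightarrow> bool" where
  "maps_into C n p \<longleftrightarrow> (\<forall>x. (\<forall>i<n. x i \<in> C) \<longrightarrow> eval_mpoly p x \<in> C)"

definition monotone_args ::
  "'a::comm_ring_1 set \<Rightarrow> ('a \<Rightarrow> 'a \<Rightarrow> bool) \<Rightarrow> nat \<Rightarrow> 'a mpoly \<Rightarrow> bool" where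
  "monotone_args C gt n p \<longleftrightarrow>
     (\<forall>x. (\<forall>i<n. x i \<in> C) \<longrightarrow>
        (\<forall>i<n. \<forall>y \<in> C. gt y (x i) \<longrightarrow> gt (eval_mpoly p (x(i := y))) (eval_mpoly p x)))"

text \<open>The default value \<open>0\<close> beyond the last argument is irrelevant for well-formed terms.\<close>

fun eval_trm :: "('f \<Rightarrow> 'a::comm_ring_1 mpoly) \<Rightarrow> ('v \<Rightarrow> 'a) \<Rightarrow> ('f, 'v) trm \<Rightarrow> 'a" where
  "eval_trm I \<alpha> (Var x) = \<alpha> x"
| "eval_trm I \<alpha> (Fun f ts) =
     eval_mpoly (I f) (\<lambda>i. if i < length ts then map (eval_trm I \<alpha>) ts ! i else 0)"

definition compatible ::
  "'a::comm_ring_1 set \<Rightarrow> ('a \<Rightarrow> 'a \<Rightarrow> bool) \<Rightarrow> ('f \<Rightarrow> 'a mpoly) \<Rightarrow> ('f, 'v) rule set \<Rightarrow> bool" where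
  "compatible C gt I R \<longleftrightarrow>
     (\<forall>(l, r) \<in> R. \<forall>\<alpha>. (\<forall>v. \<alpha> v \<in> C) \<longrightarrow> gt (eval_trm I \<alpha> l) (eval_trm I \<alpha> r))"

text \<open>The natural numbers are the subset \<open>\<nat>\<close> of \<open>int\<close>, since the polynomials have
  integer (possibly negative) coefficients.\<close>

definition poly_terminating_nat ::
  "'f set \<Rightarrow> ('f \<Rightarrow> nat) \<Rightarrow> ('f, 'v) rule set \<Rightarrow> bool" where
  "poly_terminating_nat F ar R \<longleftrightarrow>
     (\<exists>I :: 'f \<Rightarrow> int mpoly.
        (\<forall>f \<in> F. in_vars (ar f) (I f) \<and> maps_into \<nat> (ar f) (I f) \<and>
           monotone_args \<nat> (>) (ar f) (I f)) \<and>
        compatible \<nat> (>) I R)"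

definition gt_delta :: "'a::linordered_field \<Rightarrow> 'a \<Rightarrow> 'a \<Rightarrow> bool" where
  "gt_delta \<delta> x y \<longleftrightarrow> x - y \<ge> \<delta>"

text \<open>Used with \<open>TYPE(rat)\<close> and \<open>TYPE(real)\<close>.\<close>

definition poly_terminating_field ::
  "'a::linordered_field itself \<Rightarrow> 'f set \<Rightarrow> ('f \<Rightarrow> nat) \<Rightarrow> ('f, 'v) rule set \<Rightarrow> bool" where
  "poly_terminating_field D F ar R \<longleftrightarrow>
     (\<exists>(\<delta>::'a) (I :: 'f \<Rightarrow> 'a mpoly). \<delta> > 0 \<and>
        (\<forall>f \<in> F. in_vars (ar f) (I f) \<and> maps_into {0..} (ar f) (I f) \<and>
           monotone_args {0..} (gt_delta \<delta>) (ar f) (I f)) \<and>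
        compatible {0..} (gt_delta \<delta>) I R)"

end

theory Submission
  imports Defs "HOL-Computational_Algebra.Polynomial"
begin

text \<open>Over the naturals take \<open>0 = 0\<close>, \<open>s(x) = x + 1\<close>, \<open>g(x) = 3x + 2\<close> and
  \<open>f(x) = 9x(x - 1) + x + 1\<close>; the last polynomial exceeds \<open>x\<close> at every natural number,
  but not at \<open>1/2\<close>. The rules force this shape over every ordered field: comparing degrees and
  leading coefficients gives \<open>s(x) = x + t\<close>, \<open>g\<close> linear of slope greater than \<open>2\<close>, and
  \<open>f\<close> of degree at most \<open>2\<close> (because \<open>f(g(g(x)))\<close> is dominated by \<open>g\<^sup>5(f(x + 2t))\<close>).
  If \<open>z\<close> interprets the constant, the ground rules bound \<open>f\<close> from above at \<open>z\<close> and \<open>z + t\<close>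
  and from below at \<open>z + 2t\<close>. Lagrange interpolation of \<open>f\<close> through these three points then
  gives \<open>f(z + t/2) \<le> z + t/2\<close>, contradicting the rule \<open>f(x) \<rightarrow> x\<close>.\<close>

section \<open>Asymptotic comparison of polynomials\<close>

lemma eventually_lead_coeff_le_poly:
  fixes p :: "'a::linordered_field poly"
  assumes "0 < lead_coeff p"
  shows "\<forall>\<^sub>F x in at_top. lead_coeff p \<le> poly p x"
  using assms
proof (induction p)
  case 0
  then show ?case by simp
next
  case (pCons a p)
  show ?case
  proof (cases "p = 0")
    case True
    then show ?thesis by simp
  next
    case False
    define c where "c = lead_coeff p"
    have c: "0 < c" using pCons.prems False by (simp add: c_def)
    have "\<forall>\<^sub>F x in at_top. c \<le> poly p x" using pCons.IH c by (simp add: c_def)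
    then have "\<forall>\<^sub>F x in at_top. c \<le> poly (pCons a p) x"
      using eventually_ge_at_top[of "1 + \<bar>a\<bar> / c"]
    proof eventually_elim
      case (elim x)
      have "c + \<bar>a\<bar> = (1 + \<bar>a\<bar> / c) * c" using c by (simp add: distrib_right)
      also have "\<dots> \<le> x * poly p x"
      proof (rule mult_mono)
        have "0 \<le> 1 + \<bar>a\<bar> / c" using c by simp
        then show "0 \<le> x" using elim(2) by (rule order_trans)
      qed (use elim c in auto)
      finally show ?case by (simp add: abs_if split: if_splits)
    qed
    then show ?thesis using False by (simp add: c_def)
  qed
qed

lemma lead_coeff_nonneg_if_eventually_nonneg:
  fixes p :: "'a::linordered_field poly"
  assumes "\<forall>\<^sub>F x in at_top. 0 \<le> poly p x"
  shows "0 \<le> lead_coeff p"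
proof (rule ccontr)
  assume "\<not> 0 \<le> lead_coeff p"
  then have neg: "0 < lead_coeff (- p)" by (simp add: lead_coeff_minus)
  have "\<forall>\<^sub>F x :: 'a in at_top. False"
    using eventually_lead_coeff_le_poly[OF neg] assms by eventually_elim (use neg in auto)
  then show False by simp
qed

lemma lead_coeff_le_coeff_if_eventually_le:
  fixes p q :: "'a::linordered_field poly"
  assumes le: "\<forall>\<^sub>F x in at_top. poly q x \<le> poly p x" and deg: "degree p \<le> degree q"
  shows "lead_coeff q \<le> coeff p (degree q)"
proof (rule ccontr)
  assume "\<not> ?thesis"
  then have neg: "coeff (p - q) (degree q) < 0" by simp
  then have "degree q \<le> degree (p - q)" by (intro le_degree) simp
  then have "degree (p - q) = degree q" using degree_diff_le[OF deg order_refl] by simp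
  moreover have "0 \<le> lead_coeff (p - q)"
    by (rule lead_coeff_nonneg_if_eventually_nonneg) (use le in simp)
  ultimately show False using neg by simp
qed

lemma degree_le_if_eventually_le:
  fixes p q :: "'a::linordered_field poly"
  assumes "\<forall>\<^sub>F x in at_top. poly q x \<le> poly p x" and "0 < lead_coeff q"
  shows "degree q \<le> degree p"
proof (rule ccontr)
  assume "\<not> degree q \<le> degree p"
  then have "lead_coeff q \<le> coeff p (degree q)" and "coeff p (degree q) = 0"
    using lead_coeff_le_coeff_if_eventually_le[OF assms(1)] by (simp_all add: coeff_eq_0)
  then show False using assms(2) by simp
qed

lemma poly_funpow_pcompose: "poly (((\<circ>\<^sub>p) g ^^ n) p) x = (poly g ^^ n) (poly p x)"
  by (induction n) (simp_all add: poly_pcompose)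

lemma degree_funpow_pcompose:
  fixes g p :: "'a::{comm_semiring_0,semiring_no_zero_divisors} poly"
  shows "degree (((\<circ>\<^sub>p) g ^^ n) p) = degree g ^ n * degree p"
  by (induction n) (simp_all add: degree_pcompose)

lemma lead_coeff_funpow_pcompose_linear:
  fixes g p :: "'a::{comm_semiring_1,semiring_no_zero_divisors} poly"
  assumes "degree g = 1" and "0 < degree p"
  shows "lead_coeff (((\<circ>\<^sub>p) g ^^ n) p) = lead_coeff g ^ n * lead_coeff p"
proof (induction n)
  case (Suc n)
  have "0 < degree (((\<circ>\<^sub>p) g ^^ n) p)" using assms by (simp add: degree_funpow_pcompose)
  then show ?case using lead_coeff_comp[of _ g] Suc assms(1) by (simp add: mult_ac)
qed simp

section \<open>Growth constraints imposed by rewrite rules\<close>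

lemma
  fixes p q :: "'a::linordered_field poly"
  assumes le: "\<forall>\<^sub>F x in at_top. poly q (poly q (poly p x)) \<le> poly p (poly q x)"
    and deg: "0 < degree p" "0 < degree q"
    and lead: "0 < lead_coeff p" "0 < lead_coeff q"
  shows degree_eq_1_if_iterate_dominated: "degree q = 1"
    and lead_coeff_le_1_if_iterate_dominated: "degree p = 1 \<Longrightarrow> lead_coeff q \<le> 1"
proof -
  have le_comp: "\<forall>\<^sub>F x in at_top. poly (q \<circ>\<^sub>p (q \<circ>\<^sub>p p)) x \<le> poly (p \<circ>\<^sub>p q) x"
    using le by (simp add: poly_pcompose)
  have lead_comp: "lead_coeff (q \<circ>\<^sub>p (q \<circ>\<^sub>p p)) =
      lead_coeff q * (lead_coeff q * lead_coeff p ^ degree q) ^ degree q"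
    using lead_coeff_comp[of "q \<circ>\<^sub>p p" q] lead_coeff_comp[of p q] deg
    by (simp add: degree_pcompose)
  have "degree (q \<circ>\<^sub>p (q \<circ>\<^sub>p p)) \<le> degree (p \<circ>\<^sub>p q)"
    by (rule degree_le_if_eventually_le[OF le_comp]) (simp only: lead_comp, use lead in simp)
  then show deg_q: "degree q = 1" using deg by (simp add: degree_pcompose)
  assume deg_p: "degree p = 1"
  have "lead_coeff (q \<circ>\<^sub>p (q \<circ>\<^sub>p p)) \<le> lead_coeff (p \<circ>\<^sub>p q)"
    using lead_coeff_le_coeff_if_eventually_le[OF le_comp] deg_p deg_q
    by (simp add: degree_pcompose)
  then show "lead_coeff q \<le> 1"
    unfolding lead_comp using lead deg_p deg_q by (simp add: lead_coeff_comp)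
qed

lemma degree_bound_if_conjugate_dominated:
  fixes f g :: "'a::linordered_field poly"
  assumes le: "\<forall>\<^sub>F x in at_top. poly f ((poly g ^^ m) x) \<le> (poly g ^^ n) (poly f (x + c))"
    and g: "degree g = 1" "1 < lead_coeff g" and f: "0 < lead_coeff f"
  shows "m * degree f \<le> n"
proof (cases "degree f = 0")
  case False
  define a where "a = lead_coeff g"
  define l where "l = f \<circ>\<^sub>p ((\<circ>\<^sub>p) g ^^ m) [:0, 1:]"
  define r where "r = ((\<circ>\<^sub>p) g ^^ n) (f \<circ>\<^sub>p [:c, 1:])"
  have deg_l: "degree l = degree f" and deg_r: "degree r = degree f"
    using g by (simp_all add: l_def r_def degree_pcompose degree_funpow_pcompose)
  have lead_l: "lead_coeff l = lead_coeff f * a ^ (m * degree f)"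
    using lead_coeff_comp[of "((\<circ>\<^sub>p) g ^^ m) [:0, 1:]" f]
      lead_coeff_funpow_pcompose_linear[OF g(1), of "[:0, 1:]" m] g(1)
    by (simp add: l_def a_def degree_funpow_pcompose power_mult)
  have lead_r: "lead_coeff r = a ^ n * lead_coeff f"
    using lead_coeff_funpow_pcompose_linear[OF g(1), of "f \<circ>\<^sub>p [:c, 1:]" n] False
      lead_coeff_comp[of "[:c, 1:]" f]
    by (simp add: r_def a_def degree_pcompose)
  have "\<forall>\<^sub>F x in at_top. poly l x \<le> poly r x"
    using le by (simp add: l_def r_def poly_pcompose poly_funpow_pcompose add.commute)
  then have "lead_coeff l \<le> lead_coeff r"
    using lead_coeff_le_coeff_if_eventually_le deg_l deg_r by fastforce
  then have "a ^ (m * degree f) \<le> a ^ n" unfolding lead_l lead_r using f by simp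
  then show ?thesis using g(2) power_le_imp_le_exp unfolding a_def by blast
qed simp

lemma quadratic_interpolation_midpoint:
  fixes p :: "'a::field_char_0 poly"
  assumes "degree p \<le> 2"
  shows "8 * poly p (x + h / 2) = 3 * poly p x + 6 * poly p (x + h) - poly p (x + 2 * h)"
proof -
  have "p = [:coeff p 0, coeff p 1, coeff p 2:]"
    using assms
    by (intro poly_eqI) (auto simp: coeff_pCons coeff_eq_0 numeral_2_eq_2 split: nat.split)
  then obtain a b c where "p = [:c, b, a:]" by blast
  then show ?thesis by (simp add: field_simps)
qed

lemma lead_coeff_gt_if_linear_increment_gt:
  fixes p :: "'a::linordered_field poly"
  assumes "degree p = 1" and "0 < h" and "poly p x + c * h < poly p (x + h)"
  shows "c < lead_coeff p"
proof -
  obtain a b where p: "p = [:b, a:]" "a \<noteq> 0" using assms(1) by (rule degree1_coeffs)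
  then have "c * h < a * h" using assms(3) by (simp add: algebra_simps)
  then show ?thesis using p \<open>0 < h\<close> by simp
qed

lemma funpow_poly_translation: "(poly [:t, 1:] ^^ n) x = x + of_nat n * t"
  by (induction n) (simp_all add: algebra_simps)

section \<open>Monotone self-maps\<close>

definition monotone_self_map :: "'a set \<Rightarrow> ('a \<Rightarrow> 'a \<Rightarrow> bool) \<Rightarrow> ('a \<Rightarrow> 'a) \<Rightarrow> bool" where
  "monotone_self_map C gt h \<longleftrightarrow>
     (\<forall>x \<in> C. h x \<in> C) \<and> (\<forall>x \<in> C. \<forall>y \<in> C. gt y x \<longrightarrow> gt (h y) (h x))"

lemma monotone_self_map_closed: "monotone_self_map C gt h \<Longrightarrow> x \<in> C \<Longrightarrow> h x \<in> C"
  by (simp add: monotone_self_map_def)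

lemma monotone_self_map_mono:
  "monotone_self_map C gt h \<Longrightarrow> x \<in> C \<Longrightarrow> y \<in> C \<Longrightarrow> gt y x \<Longrightarrow> gt (h y) (h x)"
  by (simp add: monotone_self_map_def)

lemma gt_delta_imp_less: "0 < \<delta> \<Longrightarrow> gt_delta \<delta> x y \<Longrightarrow> y < x"
  by (simp add: gt_delta_def)

lemma all_fun_apply_iff: "(\<forall>x. P (x i)) \<longleftrightarrow> (\<forall>a. P a)"
proof
  assume all: "\<forall>x. P (x i)"
  show "\<forall>a. P a"
  proof
    fix a
    show "P a" using spec[OF all, of "\<lambda>_. a"] .
  qed
qed simp

lemma maps_into_unary_iff:
  assumes "\<And>x. eval_mpoly p x = h (x 0)"
  shows "maps_into C 1 p \<longleftrightarrow> (\<forall>a \<in> C. h a \<in> C)"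
  using all_fun_apply_iff[of "\<lambda>a. a \<in> C \<longrightarrow> h a \<in> C" 0]
  by (simp add: maps_into_def assms Ball_def)

lemma monotone_args_unary_iff:
  assumes "\<And>x. eval_mpoly p x = h (x 0)"
  shows "monotone_args C gt 1 p \<longleftrightarrow> (\<forall>a \<in> C. \<forall>b \<in> C. gt b a \<longrightarrow> gt (h b) (h a))"
  using all_fun_apply_iff[of "\<lambda>a. a \<in> C \<longrightarrow> (\<forall>b \<in> C. gt b a \<longrightarrow> gt (h b) (h a))" 0]
  by (simp add: monotone_args_def assms Ball_def)

lemma maps_into_and_monotone_args_unary_iff:
  assumes "\<And>x. eval_mpoly p x = h (x 0)"
  shows "maps_into C 1 p \<and> monotone_args C gt 1 p \<longleftrightarrow> monotone_self_map C gt h"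
  using maps_into_unary_iff[OF assms] monotone_args_unary_iff[OF assms]
  by (simp add: monotone_self_map_def)

lemma
  fixes p :: "'a::linordered_field poly"
  assumes "0 < \<delta>" and p: "monotone_self_map {0..} (gt_delta \<delta>) (poly p)"
  shows monotone_self_map_degree_pos: "0 < degree p"
    and monotone_self_map_lead_coeff_pos: "0 < lead_coeff p"
    and monotone_self_map_slope_ge_1: "degree p = 1 \<Longrightarrow> 1 \<le> lead_coeff p"
proof -
  have step: "\<delta> \<le> poly p \<delta> - poly p 0"
    using monotone_self_map_mono[OF p, of 0 \<delta>] \<open>0 < \<delta>\<close> by (simp add: gt_delta_def)
  show deg: "0 < degree p"
  proof (rule gr0I)
    assume "degree p = 0"
    then obtain a where "p = [:a:]" by (rule degree_eq_zeroE)
    then show False using step \<open>0 < \<delta>\<close> by simp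
  qed
  have "0 \<le> lead_coeff p"
    by (intro lead_coeff_nonneg_if_eventually_nonneg eventually_at_top_linorderI[of 0])
      (use monotone_self_map_closed[OF p] in simp)
  moreover have "0 \<noteq> lead_coeff p" using deg by auto
  ultimately show "0 < lead_coeff p" by (rule order_le_neq_trans)
  assume "degree p = 1"
  then obtain a b where "p = [:b, a:]" by (rule degree1_coeffs)
  then show "1 \<le> lead_coeff p" using step \<open>0 < \<delta>\<close> by simp
qed


lemma translation_if_iterate_dominated:
  fixes s g :: "'a::linordered_field poly"
  assumes "0 < \<delta>"
    and s: "monotone_self_map {0..} (gt_delta \<delta>) (poly s)"
    and g: "degree g = 1" "0 < lead_coeff g"
    and le: "\<forall>\<^sub>F x in at_top. poly s (poly s (poly g x)) \<le> poly g (poly s x)"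
  obtains t where "s = [:t, 1:]"
proof -
  note s_pos = monotone_self_map_degree_pos[OF \<open>0 < \<delta>\<close> s]
    monotone_self_map_lead_coeff_pos[OF \<open>0 < \<delta>\<close> s]
  have deg: "degree s = 1" and "lead_coeff s \<le> 1"
    using degree_eq_1_if_iterate_dominated[OF le] lead_coeff_le_1_if_iterate_dominated[OF le]
      g s_pos by simp_all
  moreover have "1 \<le> lead_coeff s"
    using monotone_self_map_slope_ge_1[OF \<open>0 < \<delta>\<close> s deg] .
  ultimately have "lead_coeff s = 1" by simp
  moreover obtain a t where "s = [:t, a:]" using deg by (rule degree1_coeffs)
  ultimately show thesis using that deg by (simp split: if_splits)
qed

section \<open>Univariate polynomials as multivariate polynomials\<close>

definition univariate :: "'a::comm_ring_1 mpoly \<Rightarrow> 'a poly" where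
  "univariate p =
     (\<Sum>m \<in> Poly_Mapping.keys p. monom (Poly_Mapping.lookup p m) (Poly_Mapping.lookup m 0))"

lemma eval_mpoly_eq_poly_univariate:
  assumes "in_vars 1 p"
  shows "eval_mpoly p x = poly (univariate p) (x 0)"
proof -
  have "(\<Prod>i \<in> Poly_Mapping.keys m. x i ^ Poly_Mapping.lookup m i) = x 0 ^ Poly_Mapping.lookup m 0"
    if "m \<in> Poly_Mapping.keys p" for m
    by (rule prod.mono_neutral_cong_left[of "{0}", simplified])
      (use assms that in \<open>auto simp: in_vars_def in_keys_iff\<close>)
  then show ?thesis
    by (simp add: eval_mpoly_def univariate_def poly_sum poly_monom)
qed

definition mpoly_of_poly :: "'a::comm_ring_1 poly \<Rightarrow> 'a mpoly" where
  "mpoly_of_poly p =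
     (\<Sum>i \<le> degree p. Poly_Mapping.single (Poly_Mapping.single 0 i) (coeff p i))"

lemma mpoly_of_poly_0 [simp]: "mpoly_of_poly 0 = 0"
  by (simp add: mpoly_of_poly_def)

lemma eval_mpoly_0 [simp]: "eval_mpoly 0 x = 0"
  by (simp add: eval_mpoly_def)

lemma eval_mpoly_add: "eval_mpoly (p + q) x = eval_mpoly p x + eval_mpoly q x"
  unfolding eval_mpoly_def by (rule setsum_keys_plus_distrib) (simp_all add: distrib_right)

lemma eval_mpoly_sum: "eval_mpoly (\<Sum>i \<in> A. p i) x = (\<Sum>i \<in> A. eval_mpoly (p i) x)"
  by (induction A rule: infinite_finite_induct) (simp_all add: eval_mpoly_add)

lemma eval_mpoly_single:
  "eval_mpoly (Poly_Mapping.single m a) x =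
     a * (\<Prod>i \<in> Poly_Mapping.keys m. x i ^ Poly_Mapping.lookup m i)"
  by (simp add: eval_mpoly_def)

lemma eval_mpoly_of_poly: "eval_mpoly (mpoly_of_poly p) x = poly p (x 0)"
  by (auto simp: mpoly_of_poly_def eval_mpoly_sum eval_mpoly_single poly_altdef intro!: sum.cong)

lemma in_vars_mpoly_of_poly: "in_vars 1 (mpoly_of_poly p)"
proof -
  have "Poly_Mapping.keys (mpoly_of_poly p) \<subseteq> range (Poly_Mapping.single 0)"
    unfolding mpoly_of_poly_def by (rule order_trans[OF keys_sum]) auto
  then show ?thesis by (fastforce simp: in_vars_def split: if_splits)
qed

section \<open>The rewrite system\<close>

abbreviation Zero :: "(nat, nat) trm" where "Zero \<equiv> Fun 0 []"
abbreviation S :: "(nat, nat) trm \<Rightarrow> (nat, nat) trm" where "S t \<equiv> Fun 1 [t]"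
abbreviation F :: "(nat, nat) trm \<Rightarrow> (nat, nat) trm" where "F t \<equiv> Fun 2 [t]"
abbreviation G :: "(nat, nat) trm \<Rightarrow> (nat, nat) trm" where "G t \<equiv> Fun 3 [t]"
abbreviation X :: "(nat, nat) trm" where "X \<equiv> Var 0"

definition symbols :: "nat set" where "symbols = {0, 1, 2, 3}"

definition arity :: "nat \<Rightarrow> nat" where "arity h = (if h = 0 then 0 else 1)"

definition rules :: "(nat, nat) rule set" where
  "rules =
     {(S (S Zero), F Zero),
      (S (S (S Zero)), F (S Zero)),
      (F (S (S Zero)), (S ^^ 20) Zero),
      (F X, X),
      (G (S X), S (S (G X))),
      (F (G X), G (G (F X))),
      ((G ^^ 5) (F (S (S X))), F ((G ^^ 2) X))}"

lemma trs_rules: "trs symbols arity rules"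
  by (simp add: trs_def symbols_def rules_def arity_def eval_nat_numeral)

definition orients_rules ::
  "'a set \<Rightarrow> ('a \<Rightarrow> 'a \<Rightarrow> bool) \<Rightarrow> 'a \<Rightarrow> ('a \<Rightarrow> 'a) \<Rightarrow> ('a \<Rightarrow> 'a) \<Rightarrow> ('a \<Rightarrow> 'a) \<Rightarrow> bool" where
  "orients_rules C gt z s f g \<longleftrightarrow>
     gt (s (s z)) (f z) \<and>
     gt (s (s (s z))) (f (s z)) \<and>
     gt (f (s (s z))) ((s ^^ 20) z) \<and>
     (\<forall>x \<in> C. gt (f x) x) \<and>
     (\<forall>x \<in> C. gt (g (s x)) (s (s (g x)))) \<and>
     (\<forall>x \<in> C. gt (f (g x)) (g (g (f x)))) \<and>
     (\<forall>x \<in> C. gt ((g ^^ 5) (f (s (s x)))) (f ((g ^^ 2) x)))"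

lemma eval_trm_unary:
  assumes "\<And>x. eval_mpoly (I k) x = h (x 0)"
  shows "eval_trm I \<alpha> (Fun k [t]) = h (eval_trm I \<alpha> t)"
  by (simp add: assms)

lemma eval_trm_unary_funpow:
  assumes "\<And>x. eval_mpoly (I k) x = h (x 0)"
  shows "eval_trm I \<alpha> (((\<lambda>t. Fun k [t]) ^^ n) t) = (h ^^ n) (eval_trm I \<alpha> t)"
  by (induction n) (simp_all add: eval_trm_unary[of I k h, OF assms] del: eval_trm.simps)

lemma ball_iff_all_assignments:
  "(\<forall>a \<in> C. P a) \<longleftrightarrow> (\<forall>\<alpha>. (\<forall>v. \<alpha> v \<in> C) \<longrightarrow> P (\<alpha> w))"
proof (intro iffI ballI)
  fix a
  assume all: "\<forall>\<alpha>. (\<forall>v. \<alpha> v \<in> C) \<longrightarrow> P (\<alpha> w)" and "a \<in> C"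
  then show "P a" using spec[OF all, of "\<lambda>_. a"] by simp
qed simp

lemma compatible_rules_iff:
  fixes I :: "nat \<Rightarrow> 'a::comm_ring_1 mpoly"
  assumes "z \<in> C"
    and zero: "eval_mpoly (I 0) (\<lambda>_. 0) = z"
    and s: "\<And>x. eval_mpoly (I 1) x = s (x 0)"
    and f: "\<And>x. eval_mpoly (I 2) x = f (x 0)"
    and g: "\<And>x. eval_mpoly (I 3) x = g (x 0)"
  shows "compatible C gt I rules \<longleftrightarrow> orients_rules C gt z s f g"
proof -
  have ground: "(\<forall>\<alpha> :: nat \<Rightarrow> 'a. (\<forall>v. \<alpha> v \<in> C) \<longrightarrow> P) \<longleftrightarrow> P" for P
    using \<open>z \<in> C\<close> ball_iff_all_assignments[of C "\<lambda>_. P"] by blast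
  have open_rule: "(\<forall>x \<in> C. P x) \<longleftrightarrow> (\<forall>\<alpha> :: nat \<Rightarrow> 'a. (\<forall>v. \<alpha> v \<in> C) \<longrightarrow> P (\<alpha> 0))" for P
    by (rule ball_iff_all_assignments)
  have eval_Zero: "eval_trm I \<alpha> Zero = z" and eval_X: "eval_trm I \<alpha> X = \<alpha> 0" for \<alpha>
    by (simp_all add: zero)
  note eval_funpow = eval_trm_unary_funpow[of I, OF s] eval_trm_unary_funpow[of I, OF g]
  note eval_unary = eval_trm_unary[of I, OF s] eval_trm_unary[of I, OF f] eval_trm_unary[of I, OF g]
  show ?thesis
    unfolding compatible_def rules_def orients_rules_def
    by (simp only: ball_simps prod.case eval_funpow eval_unary eval_Zero eval_X ground simp_thms)
      (simp only: open_rule)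
qed

section \<open>Orienting the rules over an ordered field\<close>

lemma translation_and_quadratic_if_dominated:
  fixes s f g :: "'a::linordered_field poly"
  assumes \<delta>: "0 < \<delta>"
    and s: "monotone_self_map {0..} (gt_delta \<delta>) (poly s)"
    and f: "monotone_self_map {0..} (gt_delta \<delta>) (poly f)"
    and g: "monotone_self_map {0..} (gt_delta \<delta>) (poly g)"
    and ss: "z < poly s (poly s z)"
    and gs: "\<And>x. 0 \<le> x \<Longrightarrow> poly s (poly s (poly g x)) < poly g (poly s x)"
    and fg: "\<And>x. 0 \<le> x \<Longrightarrow> poly g (poly g (poly f x)) < poly f (poly g x)"
    and fgg: "\<And>x. 0 \<le> x \<Longrightarrow>
      poly f ((poly g ^^ 2) x) < (poly g ^^ 5) (poly f (poly s (poly s x)))"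
  obtains t where "s = [:t, 1:]" and "0 < t" and "degree f \<le> 2"
proof -
  note degree_pos = monotone_self_map_degree_pos[OF \<delta>]
  note lead_coeff_pos = monotone_self_map_lead_coeff_pos[OF \<delta>]
  have "\<forall>\<^sub>F x in at_top. poly g (poly g (poly f x)) \<le> poly f (poly g x)"
    by (rule eventually_at_top_linorderI[of 0]) (rule less_imp_le[OF fg])
  then have deg_g: "degree g = 1"
    by (rule degree_eq_1_if_iterate_dominated)
      (simp_all add: degree_pos[OF f] degree_pos[OF g] lead_coeff_pos[OF f] lead_coeff_pos[OF g])
  have "\<forall>\<^sub>F x in at_top. poly s (poly s (poly g x)) \<le> poly g (poly s x)"
    by (rule eventually_at_top_linorderI[of 0]) (rule less_imp_le[OF gs])
  then obtain t where s_eq: "s = [:t, 1:]"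
    by (rule translation_if_iterate_dominated[OF \<delta> s deg_g lead_coeff_pos[OF g]])
  then have s_apply: "poly s x = x + t" for x by simp
  have t: "0 < t" using ss by (simp add: s_apply)
  have "poly g 0 + 2 * t < poly g (0 + t)" using gs[of 0] by (simp add: s_apply)
  then have slope_g: "2 < lead_coeff g"
    by (rule lead_coeff_gt_if_linear_increment_gt[OF deg_g t])
  have "\<forall>\<^sub>F x in at_top. poly f ((poly g ^^ 2) x) \<le> (poly g ^^ 5) (poly f (x + 2 * t))"
    using fgg unfolding s_apply
    by (intro eventually_at_top_linorderI[of 0]) (simp add: add.assoc less_imp_le)
  then have "2 * degree f \<le> 5"
    by (rule degree_bound_if_conjugate_dominated) (use deg_g slope_g lead_coeff_pos[OF f] in auto)
  then show thesis using that[OF s_eq t] by simp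
qed

lemma not_orients_rules_field:
  fixes s f g :: "'a::linordered_field poly"
  assumes \<delta>: "0 < \<delta>" and z: "0 \<le> z"
    and self_maps: "monotone_self_map {0..} (gt_delta \<delta>) (poly s)"
      "monotone_self_map {0..} (gt_delta \<delta>) (poly f)"
      "monotone_self_map {0..} (gt_delta \<delta>) (poly g)"
  shows "\<not> orients_rules {0..} (gt_delta \<delta>) z (poly s) (poly f) (poly g)"
proof
  assume "orients_rules {0..} (gt_delta \<delta>) z (poly s) (poly f) (poly g)"
  then have f_z: "poly f z < poly s (poly s z)"
    and f_sz: "poly f (poly s z) < poly s (poly s (poly s z))"
    and f_ssz: "(poly s ^^ 20) z < poly f (poly s (poly s z))"
    and f_gt: "\<And>x. 0 \<le> x \<Longrightarrow> x < poly f x"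
    and gs: "\<And>x. 0 \<le> x \<Longrightarrow> poly s (poly s (poly g x)) < poly g (poly s x)"
    and fg: "\<And>x. 0 \<le> x \<Longrightarrow> poly g (poly g (poly f x)) < poly f (poly g x)"
    and fgg: "\<And>x. 0 \<le> x \<Longrightarrow>
      poly f ((poly g ^^ 2) x) < (poly g ^^ 5) (poly f (poly s (poly s x)))"
    using gt_delta_imp_less[OF \<delta>] by (simp_all add: orients_rules_def)
  have "z < poly s (poly s z)" using f_gt[OF z] f_z by (rule less_trans)
  then obtain t where s: "s = [:t, 1:]" and t: "0 < t" and deg_f: "degree f \<le> 2"
    using gs fg fgg by (rule translation_and_quadratic_if_dominated[OF \<delta> self_maps])
  have "8 * poly f (z + t / 2) = 3 * poly f z + 6 * poly f (z + t) - poly f (z + 2 * t)"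
    using deg_f by (rule quadratic_interpolation_midpoint)
  also have "\<dots> < 3 * (z + 2 * t) + 6 * (z + 3 * t) - (z + 20 * t)"
    using f_z f_sz f_ssz unfolding s funpow_poly_translation by (simp add: algebra_simps)
  also have "\<dots> = 8 * (z + t / 2)" by simp
  finally show False using f_gt[of "z + t / 2"] z t by simp
qed

lemma not_poly_terminating_field_rules:
  "\<not> poly_terminating_field TYPE('a::linordered_field) symbols arity rules"
proof
  assume "poly_terminating_field TYPE('a) symbols arity rules"
  then obtain \<delta> :: 'a and I :: "nat \<Rightarrow> 'a mpoly" where \<delta>: "0 < \<delta>"
    and interp: "\<And>k. k \<in> symbols \<Longrightarrow> in_vars (arity k) (I k) \<and>
      maps_into {0..} (arity k) (I k) \<and> monotone_args {0..} (gt_delta \<delta>) (arity k) (I k)"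
    and compat: "compatible {0..} (gt_delta \<delta>) I rules"
    unfolding poly_terminating_field_def by blast
  define z where "z = eval_mpoly (I 0) (\<lambda>_. 0)"
  define h where "h k = univariate (I k)" for k
  have z: "0 \<le> z"
    using interp[of 0] by (simp add: symbols_def arity_def maps_into_def z_def)
  have unary: "in_vars 1 (I k) \<and> maps_into {0..} 1 (I k) \<and> monotone_args {0..} (gt_delta \<delta>) 1 (I k)"
    if "k \<in> {1, 2, 3}" for k
    using interp[of k] that by (auto simp: symbols_def arity_def)
  then have eval: "eval_mpoly (I k) x = poly (h k) (x 0)" if "k \<in> {1, 2, 3}" for k x
    unfolding h_def using that by (intro eval_mpoly_eq_poly_univariate) blast
  have self_map: "monotone_self_map {0..} (gt_delta \<delta>) (poly (h k))" if "k \<in> {1, 2, 3}" for k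
    using unary[OF that] maps_into_and_monotone_args_unary_iff[of "I k", OF eval[OF that]] by blast
  have "orients_rules {0..} (gt_delta \<delta>) z (poly (h 1)) (poly (h 2)) (poly (h 3))"
    using compat by (subst compatible_rules_iff[symmetric, of _ _ I]) (simp_all add: z z_def[symmetric] eval)
  then show False
    using not_orients_rules_field[OF \<delta> z] self_map by blast
qed

section \<open>Orienting the rules over the natural numbers\<close>

lemma monotone_self_map_linear_int:
  fixes a b :: int
  assumes "0 < a" and "0 \<le> b"
  shows "monotone_self_map \<nat> (>) (poly [:b, a:])"
  using assms by (simp add: monotone_self_map_def Nats_altdef1)

lemma less_quadratic_int:
  fixes x :: int
  assumes "0 \<le> x"
  shows "x < poly [:1, - 8, 9:] x"
proof -
  have "0 \<le> x * (x - 1)"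
    using assms by (cases "x = 0") (simp_all add: mult_nonneg_nonneg)
  moreover have "poly [:1, - 8, 9:] x = 9 * (x * (x - 1)) + x + 1" by (simp add: algebra_simps)
  ultimately show ?thesis by linarith
qed

lemma monotone_self_map_quadratic_int: "monotone_self_map \<nat> (>) (poly [:1, - 8, 9 :: int:])"
  unfolding monotone_self_map_def
proof (intro conjI ballI impI)
  show "poly [:1, - 8, 9:] x \<in> \<nat>" if "x \<in> \<nat>" for x :: int
    using less_quadratic_int[of x] that by (simp add: Nats_altdef1)
  show "poly [:1, - 8, 9:] x < poly [:1, - 8, 9:] y" if "x \<in> \<nat>" "x < y" for x y :: int
  proof -
    have "0 < (y - x) * (9 * (x + y) - 8)"
      using that by (intro mult_pos_pos) (auto simp: Nats_altdef1)
    then show ?thesis by (simp add: algebra_simps)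
  qed
qed

lemma orients_rules_nat:
  "orients_rules \<nat> (>) 0 (poly [:1, 1 :: int:]) (poly [:1, - 8, 9:]) (poly [:2, 3:])"
proof -
  let ?s = "poly [:1, 1 :: int:]" and ?f = "poly [:1, - 8, 9 :: int:]" and ?g = "poly [:2, 3 :: int:]"
  have ground: "?f 0 < ?s (?s 0)" "?f (?s 0) < ?s (?s (?s 0))" "20 < ?f (?s (?s 0))" by simp_all
  have gs: "?g (?s x) = ?s (?s (?g x)) + 1" for x by simp
  have fg: "?f (?g x) = ?g (?g (?f x)) + (156 * x + 4)" for x by (simp add: algebra_simps)
  have fgg: "(?g ^^ 5) (?f (?s (?s x))) = ?f ((?g ^^ 2) x) + (1458 * x\<^sup>2 + 5580 * x + 4832)" for x
    by (simp add: eval_nat_numeral algebra_simps)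
  show ?thesis
    unfolding orients_rules_def gs fg fgg funpow_poly_translation
    using ground less_quadratic_int by (auto simp: Nats_altdef1 add_nonneg_pos simp del: poly_pCons)
qed

definition nat_interpretation :: "nat \<Rightarrow> int poly" where
  "nat_interpretation k =
     (if k = 1 then [:1, 1:] else if k = 2 then [:1, - 8, 9:] else if k = 3 then [:2, 3:] else 0)"

lemma poly_terminating_nat_rules: "poly_terminating_nat symbols arity rules"
  unfolding poly_terminating_nat_def
proof (intro exI[of _ "\<lambda>k. mpoly_of_poly (nat_interpretation k)"] conjI ballI)
  let ?I = "\<lambda>k. mpoly_of_poly (nat_interpretation k)"
  fix k
  assume "k \<in> symbols"
  then consider (zero) "k = 0" | (unary) "k \<in> {1, 2, 3}" by (auto simp: symbols_def)
  then have "in_vars (arity k) (?I k) \<and> maps_into \<nat> (arity k) (?I k) \<and>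
    monotone_args \<nat> (>) (arity k) (?I k)"
  proof cases
    case zero
    then show ?thesis
      by (simp add: arity_def nat_interpretation_def in_vars_def maps_into_def monotone_args_def)
  next
    case unary
    then have "monotone_self_map \<nat> (>) (poly (nat_interpretation k))"
      by (auto simp: nat_interpretation_def monotone_self_map_linear_int
          monotone_self_map_quadratic_int simp del: poly_pCons)
    then have "maps_into \<nat> 1 (?I k) \<and> monotone_args \<nat> (>) 1 (?I k)"
      by (subst maps_into_and_monotone_args_unary_iff[OF eval_mpoly_of_poly])
    moreover have "arity k = 1" using unary by (auto simp: arity_def)
    ultimately show ?thesis using in_vars_mpoly_of_poly by simp
  qed
  then show "in_vars (arity k) (?I k)" and "maps_into \<nat> (arity k) (?I k)"
    and "monotone_args \<nat> (>) (arity k) (?I k)"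
    by blast+
next
  show "compatible \<nat> (>) (\<lambda>k. mpoly_of_poly (nat_interpretation k)) rules"
    by (subst compatible_rules_iff[where z = 0,
          OF _ _ eval_mpoly_of_poly eval_mpoly_of_poly eval_mpoly_of_poly])
      (simp_all add: nat_interpretation_def orients_rules_nat del: poly_pCons)
qed

theorem theorem4p7:
  "\<exists>(F :: nat set) (ar :: nat \<Rightarrow> nat) (R :: (nat, nat) rule set).
     trs F ar R \<and> poly_terminating_nat F ar R \<and>
     \<not> poly_terminating_field TYPE(real) F ar R \<and>
     \<not> poly_terminating_field TYPE(rat) F ar R"
  using trs_rules poly_terminating_nat_rules
    not_poly_terminating_field_rules[where ?'a = real]
    not_poly_terminating_field_rules[where ?'a = rat]
  by blast

end
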